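(* If $G$ is a finite group with non-trivial center, then $|\mathrm{Cent}(G)| \leq \frac{|G|}{2}$, with equality if and only if $G$ is an extraspecial $2$-group.
   Context: For a group $G$ and $x\in G$, $C(x)$ is the centralizer of $x$ in $G$, $Z(G)$ is the center of $G$ and $G'$ is the commutator subgroup of $G$. $\mathrm{Cent}(G)=\{C(x) : x\in G\}$ is the set of all element centralizers of $G$ (including $G=C(1)$). A finite $p$-group $G$ ($p$ a prime) is extraspecial if $G'=Z(G)$ has order $p$ and $G/G'$ is elementary abelian; an extraspecial $2$-group is the case $p=2$.
   Formalization: The equality characterization is stated only for groups of order other than 2: the cyclic group of order 2 has |Cent(G)| = 1 = |G|/2 but G' = 1 ≠ Z(G), so it is not extraspecial. The inequality is proved for all G. *)

theory Defs
  imports Complex_Main "HOL-Algebra.Generated_Groups" "HOL-Computational_Algebra.Primes"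
begin

definition centralizer :: "('a, 'b) monoid_scheme \<Rightarrow> 'a \<Rightarrow> 'a set" where
  "centralizer G x = {g \<in> carrier G. g \<otimes>\<^bsub>G\<^esub> x = x \<otimes>\<^bsub>G\<^esub> g}"

definition group_center :: "('a, 'b) monoid_scheme \<Rightarrow> 'a set" where
  "group_center G = {z \<in> carrier G. \<forall>g \<in> carrier G. z \<otimes>\<^bsub>G\<^esub> g = g \<otimes>\<^bsub>G\<^esub> z}"

definition Cent :: "('a, 'b) monoid_scheme \<Rightarrow> 'a set set" where
  "Cent G = centralizer G ` carrier G"

definition finite_p_group :: "nat \<Rightarrow> ('a, 'b) monoid_scheme \<Rightarrow> bool" where
  "finite_p_group p G \<longleftrightarrow>
     prime p \<and> group G \<and> finite (carrier G) \<and> (\<exists>n. order G = p ^ n)"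

definition elementary_abelian :: "nat \<Rightarrow> ('a, 'b) monoid_scheme \<Rightarrow> bool" where
  "elementary_abelian p G \<longleftrightarrow>
     comm_group G \<and> (\<forall>x \<in> carrier G. x [^]\<^bsub>G\<^esub> p = \<one>\<^bsub>G\<^esub>)"

text \<open>The condition \<open>G' = Z(G)\<close> of order \<open>p\<close> forces \<open>G\<close> to be non-abelian; in particular, a group
  of order \<open>p\<close> is not extraspecial.\<close>

definition extraspecial :: "nat \<Rightarrow> ('a, 'b) monoid_scheme \<Rightarrow> bool" where
  "extraspecial p G \<longleftrightarrow>
     finite_p_group p G \<and>
     derived G (carrier G) = group_center G \<and>
     card (group_center G) = p \<and>
     elementary_abelian p (G Mod (derived G (carrier G)))"

end

theory Submission
  imports Defs "HOL-Algebra.Sylow" "HOL-Algebra.Multiplicative_Group"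
begin

text \<open>
  Multiplying \<open>x\<close> by a central element does not change \<open>C(x)\<close>, so \<open>x \<mapsto> C(x)\<close> factors through a
  surjection from the cosets of the center \<open>Z\<close> onto \<open>Cent(G)\<close>. Hence \<open>|Cent(G)| \<le> |G|/|Z| \<le> |G|/2\<close>,
  and equality holds exactly when \<open>|Z| = 2\<close> and centralizers separate the cosets of \<open>Z\<close>, the property
  called \<open>centralizers_separate\<close> below. It remains to see that, for \<open>|G| \<noteq> 2\<close>, these two conditions
  together say that \<open>G\<close> is an extraspecial 2-group.

  If centralizers separate cosets, then \<open>C(x) = C(x\<inverse>)\<close> puts \<open>x\<close> and \<open>x\<inverse>\<close> in the same coset, so every
  square is central and \<open>G/Z\<close> is an elementary abelian 2-group. Thus \<open>G' \<le> Z\<close>, and every element has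
  order dividing 4 when \<open>|Z| = 2\<close>, which makes \<open>G\<close> a 2-group by Sylow's theorem. Since \<open>G'\<close> is a
  subgroup of a group of order 2, either \<open>G' = Z\<close> or \<open>G\<close> is abelian; the latter means \<open>G = Z\<close>, which
  has order 2.

  Conversely, if \<open>G'\<close> has only one nontrivial element, a commutator \<open>[x, g]\<close> is known as soon as it is
  known whether it is trivial, that is, whether \<open>g \<in> C(x)\<close>. So \<open>C(x) = C(y)\<close> forces \<open>x\<close> and \<open>y\<close> to act
  on \<open>G\<close> by the same inner automorphism, and they lie in the same coset of \<open>Z\<close>.
\<close>

section \<open>The center and its cosets\<close>

lemma (in group) commute_inv_iff:
  assumes g: "g \<in> carrier G" and x: "x \<in> carrier G"
  shows "g \<otimes> inv x = inv x \<otimes> g \<longleftrightarrow> g \<otimes> x = x \<otimes> g"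
proof -
  have "g \<otimes> inv x = inv x \<otimes> g \<longleftrightarrow> g = inv x \<otimes> (g \<otimes> x)"
    using inv_solve_right'[of "inv x \<otimes> g" g x] g x by (simp add: m_assoc)
  also have "\<dots> \<longleftrightarrow> g \<otimes> x = x \<otimes> g"
    using inv_solve_left[of g x "g \<otimes> x"] g x by simp
  finally show ?thesis .
qed

lemma (in group) center_carrier: "z \<in> group_center G \<Longrightarrow> z \<in> carrier G"
  unfolding group_center_def by blast

lemma (in group) center_commute:
  "\<lbrakk>z \<in> group_center G; g \<in> carrier G\<rbrakk> \<Longrightarrow> z \<otimes> g = g \<otimes> z"
  unfolding group_center_def by blast

lemma (in group) group_centerI:
  "\<lbrakk>z \<in> carrier G; \<And>g. g \<in> carrier G \<Longrightarrow> z \<otimes> g = g \<otimes> z\<rbrakk> \<Longrightarrow> z \<in> group_center G"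
  unfolding group_center_def by blast

lemma (in group) subgroup_group_center: "subgroup (group_center G) G"
proof (rule subgroupI)
  show "group_center G \<subseteq> carrier G" using center_carrier by blast
  have "\<one> \<in> group_center G" by (rule group_centerI) simp_all
  then show "group_center G \<noteq> {}" by blast
next
  fix a assume a: "a \<in> group_center G"
  then have c: "a \<in> carrier G" by (rule center_carrier)
  show "inv a \<in> group_center G"
  proof (rule group_centerI)
    fix g assume g: "g \<in> carrier G"
    show "inv a \<otimes> g = g \<otimes> inv a"
      using commute_inv_iff[OF g c] center_commute[OF a g] by simp
  qed (use c in simp)
next
  fix a b assume a: "a \<in> group_center G" and b: "b \<in> group_center G"
  then have c: "a \<in> carrier G" "b \<in> carrier G" by (blast intro: center_carrier)+
  show "a \<otimes> b \<in> group_center G"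
  proof (rule group_centerI)
    fix g assume g: "g \<in> carrier G"
    have "(a \<otimes> b) \<otimes> g = a \<otimes> (g \<otimes> b)"
      using center_commute[OF b g] c g by (simp add: m_assoc)
    also have "\<dots> = g \<otimes> (a \<otimes> b)"
      using center_commute[OF a g] c g by (simp flip: m_assoc)
    finally show "(a \<otimes> b) \<otimes> g = g \<otimes> (a \<otimes> b)" .
  qed (use c in simp)
qed

lemma (in group) normal_group_center: "group_center G \<lhd> G"
proof (rule normalI[OF subgroup_group_center], intro ballI)
  fix x assume "x \<in> carrier G"
  then have "z \<otimes> x = x \<otimes> z" if "z \<in> group_center G" for z
    using center_commute that by blast
  then show "group_center G #> x = x <# group_center G"
    unfolding r_coset_def l_coset_def by (intro SUP_cong) simp_all
qed

lemma (in group) r_coset_eq_iff: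
  assumes "subgroup H G" "x \<in> carrier G" "y \<in> carrier G"
  shows "H #> x = H #> y \<longleftrightarrow> x \<otimes> inv y \<in> H"
proof -
  have H: "H \<subseteq> carrier G" using assms(1) by (rule subgroup.subset)
  have "H #> x = H #> y \<longleftrightarrow> H #> (x \<otimes> inv y) = H"
    using coset_mult_inv1[OF _ assms(2,3) H] coset_mult_inv2[OF _ assms(2,3) H] by blast
  also have "\<dots> \<longleftrightarrow> x \<otimes> inv y \<in> H"
    using coset_join1[OF _ _ assms(1)] coset_join2[OF _ assms(1)] assms(2,3) by auto
  finally show ?thesis .
qed

lemma (in group) centralizer_mult_center:
  assumes z: "z \<in> group_center G" and x: "x \<in> carrier G"
  shows "centralizer G (z \<otimes> x) = centralizer G x"
proof -
  have zc: "z \<in> carrier G" using z by (rule center_carrier)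
  have "g \<otimes> (z \<otimes> x) = (z \<otimes> x) \<otimes> g \<longleftrightarrow> g \<otimes> x = x \<otimes> g" if g: "g \<in> carrier G" for g
  proof -
    have "g \<otimes> (z \<otimes> x) = z \<otimes> (g \<otimes> x)"
      using center_commute[OF z g] zc x g by (simp flip: m_assoc)
    then show ?thesis using zc x g by (simp add: m_assoc)
  qed
  then show ?thesis unfolding centralizer_def by blast
qed

lemma (in group) centralizer_inv:
  assumes "x \<in> carrier G"
  shows "centralizer G (inv x) = centralizer G x"
  unfolding centralizer_def using commute_inv_iff[OF _ assms] by blast

section \<open>Counting centralizers by cosets of the center\<close>

definition centralizers_separate :: "('a, 'b) monoid_scheme \<Rightarrow> bool" where
  "centralizers_separate G \<longleftrightarrow>
     (\<forall>x \<in> carrier G. \<forall>y \<in> carrier G. centralizer G x = centralizer G y \<longrightarrow>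
        group_center G #>\<^bsub>G\<^esub> x = group_center G #>\<^bsub>G\<^esub> y)"

text \<open>
  The surjection from cosets to centralizers sends a coset to the common centralizer of its elements,
  written as an intersection so that no representative has to be chosen.
\<close>

lemma (in group) card_Cent_cosets:
  assumes fin: "finite (carrier G)"
  shows "card (Cent G) \<le> card (rcosets (group_center G))"
    and "card (Cent G) = card (rcosets (group_center G)) \<longleftrightarrow> centralizers_separate G"
proof -
  let ?Z = "group_center G"
  define f where "f K = (\<Inter>k\<in>K. centralizer G k)" for K
  interpret Z: subgroup ?Z G by (rule subgroup_group_center)
  have f: "f (?Z #> x) = centralizer G x" if x: "x \<in> carrier G" for x
  proof -
    have "centralizer G k = centralizer G x" if "k \<in> ?Z #> x" for k
      using that centralizer_mult_center[OF _ x] unfolding r_coset_def by blast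
    moreover have "x \<in> ?Z #> x" using x by (rule rcos_self[OF _ subgroup_group_center])
    ultimately show ?thesis unfolding f_def by blast
  qed
  have cosets: "rcosets ?Z = (\<lambda>x. ?Z #> x) ` carrier G" by (auto simp: RCOSETS_def)
  have img: "Cent G = f ` (rcosets ?Z)"
    unfolding Cent_def cosets image_image using f by simp
  have fin': "finite (rcosets ?Z)" using fin by (simp add: cosets)
  show "card (Cent G) \<le> card (rcosets ?Z)"
    unfolding img by (rule card_image_le[OF fin'])
  have "card (Cent G) = card (rcosets ?Z) \<longleftrightarrow> inj_on f (rcosets ?Z)"
    unfolding img using eq_card_imp_inj_on[OF fin'] card_image by metis
  also have "\<dots> \<longleftrightarrow> centralizers_separate G"
    by (simp add: inj_on_def cosets f centralizers_separate_def)
  finally show "card (Cent G) = card (rcosets ?Z) \<longleftrightarrow> centralizers_separate G" .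
qed

lemma (in group) card_Cent_le_half:
  assumes fin: "finite (carrier G)" and nontriv: "group_center G \<noteq> {\<one>}"
  shows "2 * card (Cent G) \<le> order G"
    and "2 * card (Cent G) = order G \<longleftrightarrow> card (group_center G) = 2 \<and> centralizers_separate G"
proof -
  let ?Z = "group_center G"
  interpret Z: subgroup ?Z G by (rule subgroup_group_center)
  define r where "r = card (rcosets ?Z)"
  have finZ: "finite ?Z" using fin Z.subset finite_subset by blast
  have "card ?Z \<noteq> 0" using finZ Z.one_closed by (metis card_0_eq empty_iff)
  moreover have "card ?Z \<noteq> 1" using nontriv Z.one_closed by (metis card_1_singletonE singletonD)
  ultimately have Z2: "2 \<le> card ?Z" by linarith
  have lag: "r * card ?Z = order G" unfolding r_def by (rule lagrange[OF subgroup_group_center])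
  have "r \<noteq> 0" using lag fin order_gt_0_iff_finite by (metis mult_0 less_irrefl)
  have le: "card (Cent G) \<le> r" unfolding r_def by (rule card_Cent_cosets[OF fin])
  have rle: "2 * r \<le> order G" using lag Z2 by (metis mult.commute mult_le_mono2)
  show "2 * card (Cent G) \<le> order G" using le rle by linarith
  \<comment> \<open>Both estimates in \<open>2 |Cent(G)| \<le> 2 |G/Z| \<le> |G|\<close> must be sharp at once.\<close>
  have "2 * card (Cent G) = order G \<longleftrightarrow> 2 * r = order G \<and> card (Cent G) = r"
    using le rle by linarith
  also have "2 * r = order G \<longleftrightarrow> card ?Z = 2"
    using lag \<open>r \<noteq> 0\<close> by (metis mult.commute mult_cancel1)
  finally show "2 * card (Cent G) = order G \<longleftrightarrow> card ?Z = 2 \<and> centralizers_separate G"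
    unfolding r_def card_Cent_cosets(2)[OF fin] .
qed

section \<open>Groups of prime power exponent\<close>

lemma (in group) comm_group_if_squares_trivial:
  assumes "\<And>x. x \<in> carrier G \<Longrightarrow> x \<otimes> x = \<one>"
  shows "comm_group G"
proof (rule group_comm_groupI)
  fix x y assume xy: "x \<in> carrier G" "y \<in> carrier G"
  have self_inv: "inv a = a" if "a \<in> carrier G" for a
    using assms that inv_equality by blast
  show "x \<otimes> y = y \<otimes> x"
    using self_inv inv_mult_group xy by (metis m_closed)
qed

text \<open>
  A prime \<open>p\<close> other than \<open>q\<close> cannot divide the order of a group of \<open>q\<close>-power exponent, because Sylow's
  theorem would supply an element of order \<open>p\<close>.
\<close>

lemma (in group) order_prime_power_if_exponent:
  assumes fin: "finite (carrier G)" and q: "prime (q::nat)"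
    and ex: "\<And>x. x \<in> carrier G \<Longrightarrow> x [^] (q ^ m) = \<one>"
  shows "\<exists>n. order G = q ^ n"
proof -
  have only: "p = q" if p: "prime p" and dvd: "p dvd order G" for p
  proof (rule ccontr)
    assume "p \<noteq> q"
    obtain k where "order G = p ^ 1 * k" using dvd by auto
    then obtain H where H: "subgroup H G" "card H = p ^ 1"
      using sylow_thm[OF p is_group _ fin] by blast
    interpret H: subgroup H G by (rule H(1))
    have "h = \<one>" if h: "h \<in> H" for h
    proof -
      have hc: "h \<in> carrier G" using h by (rule H.mem_carrier)
      have "h [^] card H = \<one>"
        using group.pow_order_eq_1[OF subgroup_imp_group[OF H(1)], of h] h
        by (simp add: order_def flip: nat_pow_consistent)
      then have "ord h dvd p" using H(2) hc by (simp add: pow_eq_id)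
      moreover have "ord h dvd q ^ m" using ex[OF hc] hc by (simp add: pow_eq_id)
      moreover have "coprime p (q ^ m)"
        using p q \<open>p \<noteq> q\<close> by (simp add: primes_coprime)
      ultimately have "ord h = 1" by (metis coprime_common_divisor nat_dvd_1_iff_1)
      then show "h = \<one>" using ord_eq_1 hc by blast
    qed
    then have "H = {\<one>}" using H.one_closed by blast
    then show False using H(2) p by (simp add: prime_nat_iff)
  qed
  have "order G \<noteq> 0" using fin order_gt_0_iff_finite by simp
  then obtain k where k: "order G = q ^ multiplicity q (order G) * k" "\<not> q dvd k"
    using multiplicity_decompose'[of "order G" q] q by (metis not_prime_unit)
  have "k = 1"
  proof (rule ccontr)
    assume "k \<noteq> 1"
    then obtain p where p: "prime p" "p dvd k" using prime_factor_nat by blast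
    then have "p dvd order G" using k(1) by (metis dvd_mult)
    then show False using only p k(2) by blast
  qed
  then show ?thesis using k(1) by auto
qed

section \<open>Extraspecial 2-groups and separation of cosets\<close>

text \<open>
  The elements \<open>x\<close> and \<open>x\<inverse>\<close> have the same centralizer, hence lie in one coset of the center.
\<close>

lemma (in group) square_in_center_if_separate:
  assumes "centralizers_separate G" "x \<in> carrier G"
  shows "x \<otimes> x \<in> group_center G"
proof -
  have "group_center G #> x = group_center G #> inv x"
    using assms(1,2) inv_closed[OF assms(2)] centralizer_inv[OF assms(2)]
    unfolding centralizers_separate_def by metis
  then show ?thesis
    using r_coset_eq_iff[OF subgroup_group_center assms(2) inv_closed[OF assms(2)]] assms(2) by simp
qed

lemma (in group) elementary_abelian_Mod_center_if_separate:
  assumes "centralizers_separate G"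
  shows "elementary_abelian 2 (G Mod group_center G)"
proof -
  let ?Z = "group_center G"
  interpret Z: normal ?Z G by (rule normal_group_center)
  interpret Q: group "G Mod ?Z" by (rule Z.factorgroup_is_group)
  have sq: "K \<otimes>\<^bsub>G Mod ?Z\<^esub> K = \<one>\<^bsub>G Mod ?Z\<^esub>" if K: "K \<in> carrier (G Mod ?Z)" for K
  proof -
    obtain x where x: "x \<in> carrier G" "K = ?Z #> x"
      using K by (auto simp: FactGroup_def RCOSETS_def)
    have "?Z #> (x \<otimes> x) = ?Z"
      using coset_join2[OF _ subgroup_group_center] x(1) square_in_center_if_separate[OF assms]
      by simp
    then show ?thesis using x Z.rcos_sum by (simp add: FactGroup_def)
  qed
  then have "comm_group (G Mod ?Z)" by (rule Q.comm_group_if_squares_trivial)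
  moreover have "K [^]\<^bsub>G Mod ?Z\<^esub> (2::nat) = \<one>\<^bsub>G Mod ?Z\<^esub>" if "K \<in> carrier (G Mod ?Z)" for K
    using sq[OF that] Q.l_one[OF that]
    by (simp add: numeral_2_eq_2 del: mult_FactGroup one_FactGroup)
  ultimately show ?thesis unfolding elementary_abelian_def by blast
qed

lemma (in group) center_eq_carrier_if_derived_trivial:
  assumes "derived G (carrier G) \<subseteq> {\<one>}"
  shows "group_center G = carrier G"
proof -
  have "x \<otimes> y = y \<otimes> x" if xy: "x \<in> carrier G" "y \<in> carrier G" for x y
  proof -
    have "x \<otimes> y \<otimes> inv x \<otimes> inv y \<in> derived G (carrier G)"
      unfolding derived_def using xy by (intro generate.incl) blast
    then have "x \<otimes> y \<otimes> inv x \<otimes> inv y = \<one>" using assms by blast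
    then have "x \<otimes> y \<otimes> inv x = y"
      using inv_solve_right'[of \<one> "x \<otimes> y \<otimes> inv x" y] xy by simp
    then show ?thesis
      using inv_solve_right'[of y "x \<otimes> y" x] xy by simp
  qed
  then show ?thesis using center_carrier by (blast intro: group_centerI)
qed

text \<open>
  The hypothesis on the order excludes the abelian case: the group of order 2 satisfies the other
  hypotheses, but its derived subgroup is trivial.
\<close>

lemma (in group) extraspecial_if_separate:
  assumes fin: "finite (carrier G)" and Z2: "card (group_center G) = 2"
    and sep: "centralizers_separate G" and "order G \<noteq> 2"
  shows "extraspecial 2 G"
proof -
  let ?Z = "group_center G" and ?D = "derived G (carrier G)"
  interpret Z: normal ?Z G by (rule normal_group_center)
  have ea: "elementary_abelian 2 (G Mod ?Z)"
    using sep by (rule elementary_abelian_Mod_center_if_separate)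
  have DZ: "?D \<subseteq> ?Z"
    using derived_minimal[OF normal_group_center] ea by (simp add: elementary_abelian_def)
  interpret D: subgroup ?D G by (rule derived_is_subgroup) simp
  have "?D = ?Z"
  proof (rule ccontr)
    assume "?D \<noteq> ?Z"
    then have "?D \<subset> ?Z" using DZ by blast
    have finZ: "finite ?Z" using fin Z.subset by (rule finite_subset[rotated])
    have "card ?D \<le> Suc 0"
      using psubset_card_mono[OF finZ \<open>?D \<subset> ?Z\<close>] Z2 by linarith
    moreover have "finite ?D" using DZ finZ by (rule finite_subset)
    ultimately have "\<forall>a\<in>?D. \<forall>b\<in>?D. a = b" using card_le_Suc0_iff_eq by blast
    then have "?D \<subseteq> {\<one>}" using D.one_closed by blast
    then have "?Z = carrier G" by (rule center_eq_carrier_if_derived_trivial)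
    then show False using Z2 \<open>order G \<noteq> 2\<close> by (simp add: order_def)
  qed
  \<comment> \<open>A square is central, so its own square is trivial because the center has order 2.\<close>
  moreover have "x [^] ((2::nat) ^ 2) = \<one>" if x: "x \<in> carrier G" for x
  proof -
    have xx: "x \<otimes> x \<in> ?Z" using square_in_center_if_separate[OF sep x] .
    have "(x \<otimes> x) [^] card ?Z = \<one>"
      using group.pow_order_eq_1[OF subgroup_imp_group[OF subgroup_group_center], of "x \<otimes> x"] xx
      by (simp add: order_def flip: nat_pow_consistent)
    then show ?thesis using x Z2 by (simp add: numeral_eq_Suc m_assoc)
  qed
  then have "\<exists>n. order G = 2 ^ n"
    using order_prime_power_if_exponent[OF fin two_is_prime_nat] by blast
  ultimately show ?thesis
    unfolding extraspecial_def finite_p_group_def using ea Z2 fin is_group by simp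
qed

text \<open>
  With only two possible values, the commutator of \<open>x\<inverse>\<close> and \<open>g\<close> is determined by whether \<open>g\<close>
  centralizes \<open>x\<close>. Elements with equal centralizers therefore induce the same inner automorphism.
\<close>

lemma (in group) separate_if_derived_card_2:
  assumes D2: "card (derived G (carrier G)) = 2"
  shows "centralizers_separate G"
  unfolding centralizers_separate_def
proof (intro ballI impI)
  fix x y assume x: "x \<in> carrier G" and y: "y \<in> carrier G"
    and eq: "centralizer G x = centralizer G y"
  let ?D = "derived G (carrier G)"
  interpret D: subgroup ?D G by (rule derived_is_subgroup) simp
  have two: "a = b" if "a \<in> ?D" "b \<in> ?D" "a = \<one> \<longleftrightarrow> b = \<one>" for a b
  proof -
    obtain p q where "?D = {p, q}" using D2 unfolding card_2_iff by blast
    then have "a \<in> {p, q}" "b \<in> {p, q}" "\<one> \<in> {p, q}" using that D.one_closed by blast+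
    then show ?thesis using that(3) by auto
  qed
  define c where "c u g = inv u \<otimes> g \<otimes> u \<otimes> inv g" for u g
  have c_in: "c u g \<in> ?D" if "u \<in> carrier G" "g \<in> carrier G" for u g
  proof -
    have "inv u \<otimes> g \<otimes> inv (inv u) \<otimes> inv g \<in> derived_set G (carrier G)"
      using that by blast
    then show ?thesis
      unfolding derived_def c_def using that by (simp add: generate.incl)
  qed
  have c_one: "c u g = \<one> \<longleftrightarrow> g \<in> centralizer G u" if u: "u \<in> carrier G" and g: "g \<in> carrier G" for u g
  proof -
    have "c u g = \<one> \<longleftrightarrow> inv u \<otimes> (g \<otimes> u) = g"
      unfolding c_def using inv_solve_right'[of \<one> "inv u \<otimes> g \<otimes> u" g] u g
      by (simp add: m_assoc)
    also have "\<dots> \<longleftrightarrow> g \<otimes> u = u \<otimes> g"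
      using inv_solve_left'[of g u "g \<otimes> u"] u g by simp
    finally show ?thesis using g by (simp add: centralizer_def)
  qed
  have "(x \<otimes> inv y) \<otimes> g = g \<otimes> (x \<otimes> inv y)" if g: "g \<in> carrier G" for g
  proof -
    have "c x g = c y g"
      using c_one[OF x g] c_one[OF y g] eq by (intro two c_in x y g) simp
    then have conj: "inv x \<otimes> g \<otimes> x = inv y \<otimes> g \<otimes> y"
      unfolding c_def using x y g by simp
    have "(x \<otimes> inv y) \<otimes> g = x \<otimes> (inv y \<otimes> g \<otimes> y) \<otimes> inv y"
      using x y g by (simp add: m_assoc)
    also have "\<dots> = x \<otimes> (inv x \<otimes> g \<otimes> x) \<otimes> inv y" by (simp add: conj)
    also have "\<dots> = g \<otimes> (x \<otimes> inv y)" using x y g by (simp flip: m_assoc)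
    finally show ?thesis .
  qed
  then have "x \<otimes> inv y \<in> group_center G" using x y by (blast intro: group_centerI)
  then show "group_center G #> x = group_center G #> y"
    using r_coset_eq_iff[OF subgroup_group_center x y] by simp
qed

section \<open>The bound and its equality case\<close>

theorem proposition2p21:
  fixes G :: "('a, 'b) monoid_scheme" (structure)
  assumes "group G"
    and "finite (carrier G)"
    and "group_center G \<noteq> {\<one>}"
  shows "real (card (Cent G)) \<le> real (order G) / 2 \<and>
    (order G \<noteq> 2 \<longrightarrow>
      (real (card (Cent G)) = real (order G) / 2 \<longleftrightarrow> extraspecial 2 G))"
proof -
  interpret group G by (rule assms(1))
  have extra: "card (group_center G) = 2 \<and> centralizers_separate G \<longleftrightarrow> extraspecial 2 G"
    if "order G \<noteq> 2"
  proof
    show "extraspecial 2 G" if "card (group_center G) = 2 \<and> centralizers_separate G"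
      using extraspecial_if_separate assms(2) \<open>order G \<noteq> 2\<close> that by blast
    show "card (group_center G) = 2 \<and> centralizers_separate G" if "extraspecial 2 G"
      using that separate_if_derived_card_2 by (simp add: extraspecial_def)
  qed
  have half: "real (card (Cent G)) = real (order G) / 2 \<longleftrightarrow> 2 * card (Cent G) = order G"
    by linarith
  have "real (card (Cent G)) \<le> real (order G) / 2"
    using card_Cent_le_half(1)[OF assms(2,3)] by linarith
  then show ?thesis
    using extra unfolding half card_Cent_le_half(2)[OF assms(2,3)] by blast
qed

end
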